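(* In the two-stage settlement electricity market, there exists a unique Nash equilibrium of the load-side Cournot game with loads $\mathcal L=\{1,\dots,L\}$, $L\ge 1$, and it is given by $$d_l^{DA*}=\left(1-\frac{L\alpha^{DA}}{(L+1)\alpha^{RT}}\right)d_l+\frac{\alpha^{DA}}{(L+1)\alpha^{RT}}\sum_{k\in\mathcal L\setminus\{l\}}d_k,$$ $$d_l^{RT*}=\frac{L\alpha^{DA}}{(L+1)\alpha^{RT}}\,d_l-\frac{\alpha^{DA}}{(L+1)\alpha^{RT}}\sum_{k\in\mathcal L\setminus\{l\}}d_k,$$ for all $l\in\mathcal L$.
   Context: Let $\mathcal F$ (fast-responsive generators) and $\mathcal S$ (slow-responsive generators) be nonempty finite sets, with cost coefficients $\alpha_i^f>0,\ \beta_i^f\in\mathbb R$ for $i\in\mathcal F$ and $\alpha_j^s>0,\ \beta_j^s\in\mathbb R$ for $j\in\mathcal S$ (quadratic costs $\frac{\alpha}{2}x^2+\beta x$). Define $$\alpha^{DA}=\Big(\sum_{i\in\mathcal F}\tfrac1{\alpha_i^f}+\sum_{j\in\mathcal S}\tfrac1{\alpha_j^s}\Big)^{-1},\quad \beta^{DA}=\alpha^{DA}\Big(\sum_{i\in\mathcal F}\tfrac{\beta_i^f}{\alpha_i^f}+\sum_{j\in\mathcal S}\tfrac{\beta_j^s}{\alpha_j^s}\Big),\quad \alpha^{RT}=\Big(\sum_{i\in\mathcal F}\tfrac1{\alpha_i^f}\Big)^{-1}.$$ In particular $\alpha^{RT}>\alpha^{DA}>0$. (Generator nonnegativity constraints are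 assumed throughout not to be binding, so the price formulas below hold.) Load-side Cournot game. The players are the loads $l\in\mathcal L=\{1,\dots,L\}$; load $l$ has inelastic demand $d_l\ge 0$, and the total load $d=\sum_{l\in\mathcal L}d_l$ satisfies $d>0$. A strategy of load $l$ is a pair $\vec d_l=(d_l^{DA},d_l^{RT})$ of real numbers with $d_l^{DA}\ge 0$ and $d_l^{DA}+d_l^{RT}=d_l$ (so $d_l^{RT}$ may have any sign). Given a strategy profile $\vec d=(\vec d_l)_{l\in\mathcal L}$, put $d^{DA}=\sum_{l\in\mathcal L}d_l^{DA}$, $d^{RT}=\sum_{l\in\mathcal L}d_l^{RT}$; the day-ahead and real-time prices are $$\lambda^{DA}(\vec d)=\alpha^{DA}d^{DA}+\beta^{DA},\qquad \lambda^{RT}(\vec d)=\alpha^{RT}d^{RT}+\lambda^{DA}(\vec d).$$ The cost of load $l$ is $c_l(\vec d_l;\vec d_{-l})=\lambda^{DA}(\vec d)\,d_l^{DA}+\lambda^{RT}(\vec d)\,d_l^{RT}$, where $\vec d_{-l}$ denotes the strategies of all loads other than $l$. A profile $\vec d^*$ of strategies is a Nash equilibrium if $c_l(\vec d^*_l;\vec d^*_{-l})\le c_l(\vec d_l;\vec d^*_{-l})$ for every strategy $\vec d_l$ of load $l$ and every $l\in\mathcal L$. *)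

theory Defs
  imports Complex_Main "HOL-Library.FuncSet"
begin

(* A generator with coefficients a, b has cost (a/2) x^2 + b x. The aggregate coefficients below
   are those of the supply curves: fast and slow generators together in the day-ahead market,
   fast generators only in the real-time market. *)

definition alpha_DA :: "'f set \<Rightarrow> 's set \<Rightarrow> ('f \<Rightarrow> real) \<Rightarrow> ('s \<Rightarrow> real) \<Rightarrow> real" where
  "alpha_DA F S \<alpha>f \<alpha>s = inverse ((\<Sum>i\<in>F. 1 / \<alpha>f i) + (\<Sum>j\<in>S. 1 / \<alpha>s j))"

definition beta_DA ::
    "'f set \<Rightarrow> 's set \<Rightarrow> ('f \<Rightarrow> real) \<Rightarrow> ('f \<Rightarrow> real) \<Rightarrow> ('s \<Rightarrow> real) \<Rightarrow> ('s \<Rightarrow> real) \<Rightarrow> real" where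
  "beta_DA F S \<alpha>f \<beta>f \<alpha>s \<beta>s =
     alpha_DA F S \<alpha>f \<alpha>s * ((\<Sum>i\<in>F. \<beta>f i / \<alpha>f i) + (\<Sum>j\<in>S. \<beta>s j / \<alpha>s j))"

definition alpha_RT :: "'f set \<Rightarrow> ('f \<Rightarrow> real) \<Rightarrow> real" where
  "alpha_RT F \<alpha>f = inverse (\<Sum>i\<in>F. 1 / \<alpha>f i)"

(* A strategy is a pair (day-ahead demand, real-time demand); a profile p gives load l the
   strategy p l. The arguments aDA, bDA, aRT are the aggregate coefficients. *)

definition strategies :: "real \<Rightarrow> (real \<times> real) set" where
  "strategies d = {(dDA, dRT). 0 \<le> dDA \<and> dDA + dRT = d}"

definition price_DA :: "real \<Rightarrow> real \<Rightarrow> 'l set \<Rightarrow> ('l \<Rightarrow> real \<times> real) \<Rightarrow> real" where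
  "price_DA aDA bDA N p = aDA * (\<Sum>l\<in>N. fst (p l)) + bDA"

definition price_RT :: "real \<Rightarrow> real \<Rightarrow> real \<Rightarrow> 'l set \<Rightarrow> ('l \<Rightarrow> real \<times> real) \<Rightarrow> real" where
  "price_RT aDA bDA aRT N p = aRT * (\<Sum>l\<in>N. snd (p l)) + price_DA aDA bDA N p"

definition load_cost ::
    "real \<Rightarrow> real \<Rightarrow> real \<Rightarrow> 'l set \<Rightarrow> 'l \<Rightarrow> ('l \<Rightarrow> real \<times> real) \<Rightarrow> real" where
  "load_cost aDA bDA aRT N l p =
     price_DA aDA bDA N p * fst (p l) + price_RT aDA bDA aRT N p * snd (p l)"

(* Profiles are extensional functions on the player set N, so that equality of profiles is
   equality of the strategies of all players. *)

definition nash_equilibrium ::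
    "'l set \<Rightarrow> ('l \<Rightarrow> 'a set) \<Rightarrow> ('l \<Rightarrow> ('l \<Rightarrow> 'a) \<Rightarrow> real) \<Rightarrow> ('l \<Rightarrow> 'a) \<Rightarrow> bool" where
  "nash_equilibrium N X c p \<longleftrightarrow>
     p \<in> (\<Pi>\<^sub>E l\<in>N. X l) \<and> (\<forall>l\<in>N. \<forall>s\<in>X l. c l p \<le> c l (p(l := s)))"

definition load_cournot_equilibrium ::
    "'f set \<Rightarrow> 's set \<Rightarrow> ('f \<Rightarrow> real) \<Rightarrow> ('f \<Rightarrow> real) \<Rightarrow> ('s \<Rightarrow> real) \<Rightarrow> ('s \<Rightarrow> real) \<Rightarrow>
     'l set \<Rightarrow> ('l \<Rightarrow> real) \<Rightarrow> ('l \<Rightarrow> real \<times> real) \<Rightarrow> bool" where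
  "load_cournot_equilibrium F S \<alpha>f \<beta>f \<alpha>s \<beta>s N d p \<longleftrightarrow>
     nash_equilibrium N (\<lambda>l. strategies (d l))
       (load_cost (alpha_DA F S \<alpha>f \<alpha>s) (beta_DA F S \<alpha>f \<beta>f \<alpha>s \<beta>s) (alpha_RT F \<alpha>f) N) p"

end

theory Submission
  imports Defs
begin

text \<open>
  In terms of the real-time demands \<open>y\<^sub>l\<close>, with total \<open>Y\<close>, the marginal cost of load \<open>l\<close> is
  \<open>\<alpha>\<^sup>R\<^sup>T (Y + y\<^sub>l) - \<alpha>\<^sup>D\<^sup>A d\<^sub>l\<close>, subject to \<open>y\<^sub>l \<le> d\<^sub>l\<close>. If the constraint were strictly binding for some
  load, then \<open>Y < 0\<close> because \<open>\<alpha>\<^sup>D\<^sup>A < \<alpha>\<^sup>R\<^sup>T\<close>; but \<open>Y < 0\<close> makes every best response nonnegative, a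
  contradiction. So all marginal costs vanish, and summing these linear equations over the loads
  determines \<open>Y\<close> and then every \<open>y\<^sub>l\<close>.
\<close>

section \<open>Order of the aggregate price slopes\<close>

lemma alpha_DA_pos:
  fixes \<alpha>f :: "'f \<Rightarrow> real" and \<alpha>s :: "'s \<Rightarrow> real"
  assumes "finite F" "F \<noteq> {}" "\<And>i. i \<in> F \<Longrightarrow> \<alpha>f i > 0" "\<And>j. j \<in> S \<Longrightarrow> \<alpha>s j > 0"
  shows "0 < alpha_DA F S \<alpha>f \<alpha>s"
proof -
  have "0 < (\<Sum>i\<in>F. 1 / \<alpha>f i)"
    using assms by (intro sum_pos) auto
  moreover have "0 \<le> (\<Sum>j\<in>S. 1 / \<alpha>s j)"
    using assms(4) by (intro sum_nonneg) (simp add: less_imp_le)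
  ultimately show ?thesis
    by (simp add: alpha_DA_def)
qed

lemma alpha_DA_less_alpha_RT:
  fixes \<alpha>f :: "'f \<Rightarrow> real" and \<alpha>s :: "'s \<Rightarrow> real"
  assumes "finite F" "F \<noteq> {}" "finite S" "S \<noteq> {}"
    and "\<And>i. i \<in> F \<Longrightarrow> \<alpha>f i > 0" "\<And>j. j \<in> S \<Longrightarrow> \<alpha>s j > 0"
  shows "alpha_DA F S \<alpha>f \<alpha>s < alpha_RT F \<alpha>f"
proof -
  have "0 < (\<Sum>i\<in>F. 1 / \<alpha>f i)" "0 < (\<Sum>j\<in>S. 1 / \<alpha>s j)"
    using assms by (auto intro!: sum_pos)
  then show ?thesis
    unfolding alpha_DA_def alpha_RT_def by (intro less_imp_inverse_less) auto
qed

section \<open>Unilateral deviations of one load\<close>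

lemma sum_fun_upd:
  fixes f :: "'b \<Rightarrow> 'c :: ab_group_add"
  assumes "finite N" "l \<in> N"
  shows "(\<Sum>k\<in>N. f ((p(l := s)) k)) = (\<Sum>k\<in>N. f (p k)) - f (p l) + f s"
proof -
  have "(\<Sum>k\<in>N - {l}. f ((p(l := s)) k)) = (\<Sum>k\<in>N - {l}. f (p k))"
    by (rule sum.cong) auto
  then show ?thesis
    using sum.remove[OF assms, of "\<lambda>k. f ((p(l := s)) k)"] sum.remove[OF assms, of "\<lambda>k. f (p k)"]
    by simp
qed

text \<open>With totals X and Y and own demands x + y = d, the cost is (a X + b) d + r Y y. Moving t
  from day-ahead to real time turns X into X - t, Y into Y + t and y into y + t, so the change is
  exactly quadratic in t and free of \<open>b\<close>.\<close>

lemma load_cost_shift: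
  assumes "finite N" "l \<in> N" "fst (p l) + snd (p l) = d"
  shows "load_cost a b r N l (p(l := (fst (p l) - t, snd (p l) + t))) =
    load_cost a b r N l p + (r * ((\<Sum>k\<in>N. snd (p k)) + snd (p l)) - a * d) * t + r * t\<^sup>2"
  unfolding load_cost_def price_DA_def price_RT_def sum_fun_upd[OF assms(1,2)] assms(3)[symmetric]
  by (simp add: algebra_simps power2_eq_square)

text \<open>The strategy set is a ray. It is parametrised by t from any of its points
  \<open>x\<close>, and it ends where the day-ahead demand reaches zero.\<close>

lemma shift_mem_strategies:
  assumes "x \<in> strategies d"
  shows "(fst x - t, snd x + t) \<in> strategies d \<longleftrightarrow> t \<le> fst x"
  using assms by (auto simp: strategies_def)

lemma strategy_eq_shift:
  assumes "x \<in> strategies d" "s \<in> strategies d"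
  shows "s = (fst x - (snd s - snd x), snd x + (snd s - snd x))"
  using assms by (auto simp: strategies_def)

text \<open>First-order condition at t = 0 on a half-line unbounded below: negative t is always
  feasible, which excludes a positive slope, and small positive t is feasible once \<open>m\<close>
  is positive, which excludes a negative one.\<close>

lemma quadratic_min_halfline:
  fixes g r m :: real
  assumes "0 < r" "0 \<le> m" "\<And>t. t \<le> m \<Longrightarrow> 0 \<le> g * t + r * t\<^sup>2"
  shows "g \<le> 0" and "0 < m \<Longrightarrow> g = 0"
proof -
  \<comment> \<open>The quadratic is negative strictly between its roots 0 and -g/r. Steps against
    the sign of \<open>g\<close> of length at most |g|/(2r) go no further than the midpoint, its
    minimiser.\<close>
  have neg: "g * t + r * t\<^sup>2 < 0" if "t * g < 0" "\<bar>t\<bar> \<le> \<bar>g\<bar> / (2 * r)" for t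
  proof -
    have "r * \<bar>t\<bar> \<le> \<bar>g\<bar> / 2"
      using that(2) assms(1) by (simp add: field_simps)
    then have "r * \<bar>t\<bar> * \<bar>t\<bar> \<le> \<bar>g\<bar> / 2 * \<bar>t\<bar>"
      by (rule mult_right_mono) simp
    moreover have "\<bar>g\<bar> * \<bar>t\<bar> = - (t * g)"
      using that(1) by (simp add: abs_mult[symmetric] mult.commute)
    ultimately show ?thesis
      using that(1) by (simp add: power2_eq_square algebra_simps)
  qed
  show "g \<le> 0"
  proof (rule ccontr)
    assume "\<not> g \<le> 0"
    then have "- (g / (2 * r)) \<le> m" "- (g / (2 * r)) * g < 0"
        "\<bar>- (g / (2 * r))\<bar> \<le> \<bar>g\<bar> / (2 * r)"
      using assms(1,2) by (auto simp: abs_if field_simps intro: order_trans[of _ 0])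
    then show False
      using neg assms(3) by (meson not_less)
  qed
  show "g = 0" if "0 < m"
  proof (rule ccontr)
    assume "g \<noteq> 0"
    then have "g < 0" using \<open>g \<le> 0\<close> by simp
    \<comment> \<open>The minimum with \<open>m\<close> keeps the step feasible if the minimiser
      lies beyond the end of the half-line.\<close>
    define t where "t = min m (\<bar>g\<bar> / (2 * r))"
    have "0 < \<bar>g\<bar> / (2 * r)"
      using \<open>g < 0\<close> assms(1) by (intro divide_pos_pos) auto
    then have "0 < t" "t \<le> m" "\<bar>t\<bar> \<le> \<bar>g\<bar> / (2 * r)"
      using that unfolding t_def by linarith+
    moreover have "t * g < 0"
      using \<open>g < 0\<close> \<open>0 < t\<close> by (simp add: mult_pos_neg)
    ultimately show False
      using neg assms(3) by (meson not_less)
  qed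
qed

section \<open>Equilibrium and vanishing marginal costs\<close>

lemma nash_equilibrium_imp_marginal_cost_zero:
  fixes d :: "'l \<Rightarrow> real"
  assumes "finite N" "0 < a" "a < r" "\<And>l. l \<in> N \<Longrightarrow> 0 \<le> d l"
    and nash: "nash_equilibrium N (\<lambda>l. strategies (d l)) (load_cost a b r N) p"
    and "l \<in> N"
  shows "r * ((\<Sum>k\<in>N. snd (p k)) + snd (p l)) = a * d l"
proof -
  define Y where "Y = (\<Sum>k\<in>N. snd (p k))"
  define g where "g k = r * (Y + snd (p k)) - a * d k" for k
  have strat: "p k \<in> strategies (d k)" if "k \<in> N" for k
    using nash that by (auto simp: nash_equilibrium_def PiE_iff)
  have total: "fst (p k) + snd (p k) = d k" and nonneg: "0 \<le> fst (p k)" if "k \<in> N" for k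
    using strat[OF that] by (auto simp: strategies_def)
  have min: "0 \<le> g k * t + r * t\<^sup>2" if "k \<in> N" "t \<le> fst (p k)" for k t
  proof -
    have "load_cost a b r N k p \<le> load_cost a b r N k (p(k := (fst (p k) - t, snd (p k) + t)))"
      using nash that shift_mem_strategies[OF strat] by (auto simp: nash_equilibrium_def)
    then show ?thesis
      using load_cost_shift[where p = p and t = t, OF assms(1) that(1) total[OF that(1)], of a b r] by (simp add: g_def Y_def)
  qed
  have "0 < r" using assms by simp
  have le: "g k \<le> 0" and eq: "0 < fst (p k) \<Longrightarrow> g k = 0" if "k \<in> N" for k
    using quadratic_min_halfline[OF \<open>0 < r\<close> nonneg[OF that], of "g k"] min[OF that] by auto
  have "0 \<le> Y"
  proof (rule ccontr)
    assume "\<not> 0 \<le> Y"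
    have "0 \<le> snd (p k)" if "k \<in> N" for k
    proof (cases "0 < fst (p k)")
      case True
      then have "r * (Y + snd (p k)) = a * d k"
        using eq[OF that] by (simp add: g_def)
      then have "0 \<le> r * (Y + snd (p k))"
        using assms(2) assms(4)[OF that] by simp
      then have "0 \<le> Y + snd (p k)"
        using \<open>0 < r\<close> by (simp add: zero_le_mult_iff)
      then show ?thesis
        using \<open>\<not> 0 \<le> Y\<close> by simp
    next
      case False
      then show ?thesis
        using total[OF that] nonneg[OF that] assms(4)[OF that] by simp
    qed
    then have "0 \<le> Y"
      unfolding Y_def by (rule sum_nonneg)
    then show False
      using \<open>\<not> 0 \<le> Y\<close> by simp
  qed
  have "g l = 0"
  proof (cases "0 < fst (p l)")
    case False
    \<comment> \<open>At the boundary the real-time demand is all of \<open>d l\<close>. The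
      nonnegative total and a < r then give the inequality opposite to \<open>le\<close>, so a load
      with no day-ahead demand also has zero marginal cost.\<close>
    then have "g l = r * Y + (r - a) * d l"
      using total[OF \<open>l \<in> N\<close>] nonneg[OF \<open>l \<in> N\<close>] by (simp add: g_def algebra_simps)
    then have "0 \<le> g l"
      using \<open>0 < r\<close> \<open>0 \<le> Y\<close> assms(3) assms(4)[OF \<open>l \<in> N\<close>] by simp
    then show ?thesis
      using le[OF \<open>l \<in> N\<close>] by simp
  qed (rule eq[OF \<open>l \<in> N\<close>])
  then show ?thesis
    by (simp add: g_def Y_def)
qed

text \<open>Every strategy of a load is a shift of its current one by some t. With no linear term
  left, the deviation raises the cost by exactly r t^2.\<close>

lemma nash_equilibrium_if_marginal_cost_zero:
  fixes d :: "'l \<Rightarrow> real"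
  assumes "finite N" "0 \<le> r" "p \<in> (\<Pi>\<^sub>E l\<in>N. strategies (d l))"
    and zero: "\<And>l. l \<in> N \<Longrightarrow> r * ((\<Sum>k\<in>N. snd (p k)) + snd (p l)) = a * d l"
  shows "nash_equilibrium N (\<lambda>l. strategies (d l)) (load_cost a b r N) p"
  unfolding nash_equilibrium_def
proof (intro conjI ballI)
  fix l s
  assume "l \<in> N" "s \<in> strategies (d l)"
  define t where "t = snd s - snd (p l)"
  have strat: "p l \<in> strategies (d l)"
    using assms(3) \<open>l \<in> N\<close> by auto
  then have total: "fst (p l) + snd (p l) = d l"
    by (auto simp: strategies_def)
  have "s = (fst (p l) - t, snd (p l) + t)"
    unfolding t_def using strategy_eq_shift[OF strat \<open>s \<in> _\<close>] .
  then have "load_cost a b r N l (p(l := s)) = load_cost a b r N l p + r * t\<^sup>2"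
    using load_cost_shift[where p = p and t = t, OF assms(1) \<open>l \<in> N\<close> total, of a b r] zero[OF \<open>l \<in> N\<close>]
    by simp
  then show "load_cost a b r N l p \<le> load_cost a b r N l (p(l := s))"
    using \<open>0 \<le> r\<close> by simp
qed (rule assms(3))

section \<open>Solving the linear system\<close>

lemma marginal_cost_zero_iff:
  fixes y d :: "'l \<Rightarrow> real"
  assumes "0 < r"
  shows "(\<forall>l\<in>N. r * ((\<Sum>k\<in>N. y k) + y l) = a * d l) \<longleftrightarrow>
    (\<forall>l\<in>N. y l = a / r * (d l - (\<Sum>k\<in>N. d k) / (real (card N) + 1)))"
    (is "?lhs \<longleftrightarrow> (\<forall>l\<in>N. y l = a / r * (d l - ?D / (?n + 1)))")
proof
  assume ?lhs
  have y: "y l = a / r * d l - sum y N" if "l \<in> N" for l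
    using \<open>?lhs\<close> that assms by (force simp: field_simps)
  \<comment> \<open>Summing over the loads puts the total on the right \<open>?n\<close> times; with
    the copy on the left this yields the factor \<open>?n + 1\<close>.\<close>
  have "sum y N = (\<Sum>l\<in>N. a / r * d l - sum y N)"
    using y by (rule sum.cong[OF refl])
  also have "\<dots> = a / r * ?D - ?n * sum y N"
    by (simp add: sum_subtractf sum_distrib_left)
  finally have "(?n + 1) * sum y N = a / r * ?D"
    by (simp add: algebra_simps)
  then have sum_y: "sum y N = a / r * (?D / (?n + 1))"
    using assms by (auto simp: eq_divide_eq mult_ac add_nonneg_eq_0_iff)
  show "\<forall>l\<in>N. y l = a / r * (d l - ?D / (?n + 1))"
  proof
    fix l
    assume "l \<in> N"
    show "y l = a / r * (d l - ?D / (?n + 1))"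
      unfolding y[OF \<open>l \<in> N\<close>] sum_y by (rule right_diff_distrib[symmetric])
  qed
next
  assume y: "\<forall>l\<in>N. y l = a / r * (d l - ?D / (?n + 1))"
  \<comment> \<open>The candidate must reproduce the total it was built from: D - n D/(n+1) =
    D/(n+1).\<close>
  then have "sum y N = (\<Sum>l\<in>N. a / r * (d l - ?D / (?n + 1)))"
    by (intro sum.cong) auto
  also have "\<dots> = a / r * (?D - ?n * (?D / (?n + 1)))"
    unfolding sum_distrib_left[symmetric] by (simp add: sum_subtractf)
  also have "?D - ?n * (?D / (?n + 1)) = ?D / (?n + 1)"
    by (simp add: field_simps)
  finally have sum_y: "sum y N = a / r * (?D / (?n + 1))" .
  show ?lhs
  proof
    fix l
    assume "l \<in> N"
    have "sum y N + y l = a / r * d l"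
      unfolding sum_y using y \<open>l \<in> N\<close> by (simp only: right_diff_distrib)
    then show "r * (sum y N + y l) = a * d l"
      using assms by simp
  qed
qed

lemma nash_equilibrium_iff:
  fixes d :: "'l \<Rightarrow> real" and N :: "'l set"
  defines "y \<equiv> \<lambda>a r l. a / r * (d l - (\<Sum>k\<in>N. d k) / (real (card N) + 1))"
  assumes "finite N" "0 < a" "a < r" "\<And>l. l \<in> N \<Longrightarrow> 0 \<le> d l"
  shows "nash_equilibrium N (\<lambda>l. strategies (d l)) (load_cost a b r N) p \<longleftrightarrow>
    p = (\<lambda>l\<in>N. (d l - y a r l, y a r l))"
proof
  assume nash: "nash_equilibrium N (\<lambda>l. strategies (d l)) (load_cost a b r N) p"
  then have PiE: "p \<in> (\<Pi>\<^sub>E l\<in>N. strategies (d l))"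
    by (simp add: nash_equilibrium_def)
  have "\<forall>l\<in>N. snd (p l) = y a r l"
    using nash_equilibrium_imp_marginal_cost_zero[OF assms(2-5) nash] assms(3,4)
    unfolding y_def by (subst marginal_cost_zero_iff[symmetric]) auto
  moreover have "fst (p l) + snd (p l) = d l" if "l \<in> N" for l
    using PiE that by (auto simp: PiE_iff strategies_def)
  ultimately show "p = (\<lambda>l\<in>N. (d l - y a r l, y a r l))"
    using PiE by (intro extensionalityI[of _ N]) (auto simp: PiE_iff prod_eq_iff algebra_simps)
next
  assume p: "p = (\<lambda>l\<in>N. (d l - y a r l, y a r l))"
  \<comment> \<open>Day-ahead demand stays nonnegative without truncation: dropping the subtracted
    share of the total only increases the value, and a/r is below 1.\<close>
  have le: "y a r l \<le> d l" if "l \<in> N" for l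
  proof -
    have "0 \<le> (\<Sum>k\<in>N. d k)"
      using assms(5) by (rule sum_nonneg)
    then have "y a r l \<le> a / r * d l"
      unfolding y_def using assms(3,4) by (intro mult_left_mono) auto
    also have "\<dots> \<le> 1 * d l"
      using assms(3,4) assms(5)[OF that] by (intro mult_right_mono) auto
    finally show ?thesis by simp
  qed
  show "nash_equilibrium N (\<lambda>l. strategies (d l)) (load_cost a b r N) p"
  proof (rule nash_equilibrium_if_marginal_cost_zero)
    show "p \<in> (\<Pi>\<^sub>E l\<in>N. strategies (d l))"
      unfolding p using le by (auto simp: strategies_def)
    have "\<forall>l\<in>N. r * ((\<Sum>k\<in>N. snd (p k)) + snd (p l)) = a * d l"
      using assms(3,4) by (subst marginal_cost_zero_iff) (auto simp: p y_def)
    then show "r * ((\<Sum>k\<in>N. snd (p k)) + snd (p l)) = a * d l" if "l \<in> N" for l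
      using that by blast
  qed (use assms in auto)
qed

theorem theorem3:
  fixes F :: "'f set" and S :: "'s set"
    and \<alpha>f \<beta>f :: "'f \<Rightarrow> real" and \<alpha>s \<beta>s :: "'s \<Rightarrow> real"
    and L :: nat and d :: "nat \<Rightarrow> real"
  assumes "finite F" and "F \<noteq> {}" and "finite S" and "S \<noteq> {}"
    and "\<And>i. i \<in> F \<Longrightarrow> \<alpha>f i > 0" and "\<And>j. j \<in> S \<Longrightarrow> \<alpha>s j > 0"
    and "L \<ge> 1"
    and "\<And>l. l \<in> {1..L} \<Longrightarrow> d l \<ge> 0" and "(\<Sum>l\<in>{1..L}. d l) > 0"
  shows "(\<exists>!p. load_cournot_equilibrium F S \<alpha>f \<beta>f \<alpha>s \<beta>s {1..L} d p) \<and>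
    (\<forall>p. load_cournot_equilibrium F S \<alpha>f \<beta>f \<alpha>s \<beta>s {1..L} d p \<longrightarrow>
      (\<forall>l\<in>{1..L}.
        fst (p l) = (1 - real L * alpha_DA F S \<alpha>f \<alpha>s / ((real L + 1) * alpha_RT F \<alpha>f)) * d l
          + alpha_DA F S \<alpha>f \<alpha>s / ((real L + 1) * alpha_RT F \<alpha>f) * (\<Sum>k\<in>{1..L} - {l}. d k) \<and>
        snd (p l) = real L * alpha_DA F S \<alpha>f \<alpha>s / ((real L + 1) * alpha_RT F \<alpha>f) * d l
          - alpha_DA F S \<alpha>f \<alpha>s / ((real L + 1) * alpha_RT F \<alpha>f) * (\<Sum>k\<in>{1..L} - {l}. d k)))"
proof -
  define a r where "a = alpha_DA F S \<alpha>f \<alpha>s" and "r = alpha_RT F \<alpha>f"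
  define y where "y l = a / r * (d l - (\<Sum>k\<in>{1..L}. d k) / (real L + 1))" for l
  have a: "0 < a" "a < r"
    using assms unfolding a_def r_def by (auto intro: alpha_DA_pos alpha_DA_less_alpha_RT)
  \<comment> \<open>Characterising equilibria as one explicit profile gives existence, uniqueness
    and the formulas at once.\<close>
  have equilibrium_iff: "load_cournot_equilibrium F S \<alpha>f \<beta>f \<alpha>s \<beta>s {1..L} d p \<longleftrightarrow>
      p = (\<lambda>l\<in>{1..L}. (d l - y l, y l))" for p
    using nash_equilibrium_iff[where d = d and N = "{1..L}", OF finite_atLeastAtMost a assms(8)]
    by (simp add: load_cournot_equilibrium_def y_def flip: a_def r_def)
  have y: "y l = real L * a / ((real L + 1) * r) * d l
      - a / ((real L + 1) * r) * (\<Sum>k\<in>{1..L} - {l}. d k)" if "l \<in> {1..L}" for l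
  proof -
    let ?D' = "\<Sum>k\<in>{1..L} - {l}. d k"
    \<comment> \<open>Splitting off the load's own share of the total leaves it the weight 1 -
      1/(L+1) = L/(L+1).\<close>
    have "d l - (d l + ?D') / (real L + 1) = (real L * d l - ?D') / (real L + 1)"
      by (simp add: field_simps)
    then show ?thesis
      unfolding y_def sum.remove[OF finite_atLeastAtMost that, of d]
      by (simp add: diff_divide_distrib right_diff_distrib mult_ac)
  qed
  show ?thesis
    unfolding equilibrium_iff a_def[symmetric] r_def[symmetric]
    by (auto simp: y algebra_simps)
qed

end
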